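(* Let $(G,\precsim)$ be a C-quasi-ordered group. For any $g,h\in G$ the following conditions are equivalent: $g\in T_h$; $\ h\in T_g$; $\ T_g=T_h$; $\ T_g\cap T_h\neq\varnothing$; $\ G_g=G_h$; $\ G^g=G^h$.
   Context: A quasi-order is a reflexive, transitive and total binary relation $\precsim$; $a\sim b$ means $a\precsim b\precsim a$, and $a\precnsim b$ means $a\precsim b$ and $a\nsim b$. An element $c$ is between $a$ and $b$ if $a\precsim c\precsim b$ or $b\precsim c\precsim a$. A C-relation on a set is a ternary relation $C$ such that for all $x,y,z,w$: $C(x,y,z)\Rightarrow C(x,z,y)$; $C(x,y,z)\Rightarrow\neg C(y,x,z)$; $C(x,y,z)\Rightarrow C(w,y,z)\vee C(x,w,z)$; $x\neq y\Rightarrow C(x,y,y)$. On a group it is compatible if $C(x,y,z)$ implies $C(vxu,vyu,vzu)$ for all $x,y,z,u,v$. A C-quasi-order on a group $G$ is a quasi-order of the form $x\precsim y\Leftrightarrow\neg C(x,y,1)$ with $C$ a compatible C-relation; a C-quasi-ordered group is a group with a C-quasi-order. $g$ is v-type if $g\sim g^{-1}$; $o^+$-type if $g^{-1}\precnsim g$; $o^-$-type if $g\precnsim g^{-1}$. For $g\neq1$: if $g$ is v-type, $T_g$ is the set of v-type $h\neq1$ such that there is no $o^+$-type element between $h$ and $g$, and $G_g:=\{h\mid h\precnsim t\text{ for all }t\in T_g\}$; if $g$ is $o^+$-type, $T_g:=T_g^+\cup (T_g^+)^{-1}$, where $T_g^+$ is the set of $o^+$-type $h$ such that every element between $g$ and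 $h$ is $o^+$-type, and $G_g:=\{h\mid h\precsim g^{-1}\wedge h^{-1}\precsim g^{-1}\}$; if $g$ is $o^-$-type, $T_g:=T_{g^{-1}}$ and $G_g:=G_{g^{-1}}$. In all these cases $G^g:=G_g\cup T_g$. For $g=1$, $T_1=G^1=G_1=\{1\}$.
   Formalization: The condition G_g=G_h is replaced by "G_g=G_h and (g=1 iff h=1)": with G_1={1}, the original fails for the trivial C-relation C(x,y,z) iff y=z≠x on a nontrivial group, where G_g={1}=G_1 but T_g≠T_1 for g≠1. *)

theory Defs
  imports "HOL-Algebra.Group"
begin

definition quasi_order_on :: "'a set \<Rightarrow> ('a \<Rightarrow> 'a \<Rightarrow> bool) \<Rightarrow> bool" where
  "quasi_order_on A qle \<longleftrightarrow> reflp_on A qle \<and> transp_on A qle \<and> totalp_on A qle"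

definition qo_equiv :: "('a \<Rightarrow> 'a \<Rightarrow> bool) \<Rightarrow> 'a \<Rightarrow> 'a \<Rightarrow> bool" where
  "qo_equiv qle a b \<longleftrightarrow> qle a b \<and> qle b a"

definition qo_less :: "('a \<Rightarrow> 'a \<Rightarrow> bool) \<Rightarrow> 'a \<Rightarrow> 'a \<Rightarrow> bool" where
  "qo_less qle a b \<longleftrightarrow> qle a b \<and> \<not> qo_equiv qle a b"

definition qo_between :: "('a \<Rightarrow> 'a \<Rightarrow> bool) \<Rightarrow> 'a \<Rightarrow> 'a \<Rightarrow> 'a \<Rightarrow> bool" where
  "qo_between qle a b c \<longleftrightarrow> (qle a c \<and> qle c b) \<or> (qle b c \<and> qle c a)"

definition C_relation_on :: "'a set \<Rightarrow> ('a \<Rightarrow> 'a \<Rightarrow> 'a \<Rightarrow> bool) \<Rightarrow> bool" where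
  "C_relation_on A C \<longleftrightarrow>
     (\<forall>x\<in>A. \<forall>y\<in>A. \<forall>z\<in>A. C x y z \<longrightarrow> C x z y) \<and>
     (\<forall>x\<in>A. \<forall>y\<in>A. \<forall>z\<in>A. C x y z \<longrightarrow> \<not> C y x z) \<and>
     (\<forall>x\<in>A. \<forall>y\<in>A. \<forall>z\<in>A. \<forall>w\<in>A. C x y z \<longrightarrow> C w y z \<or> C x w z) \<and>
     (\<forall>x\<in>A. \<forall>y\<in>A. x \<noteq> y \<longrightarrow> C x y y)"

definition C_compatible :: "('a, 'm) monoid_scheme \<Rightarrow> ('a \<Rightarrow> 'a \<Rightarrow> 'a \<Rightarrow> bool) \<Rightarrow> bool" where
  "C_compatible G C \<longleftrightarrow>
     (\<forall>x\<in>carrier G. \<forall>y\<in>carrier G. \<forall>z\<in>carrier G. \<forall>u\<in>carrier G. \<forall>v\<in>carrier G.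
        C x y z \<longrightarrow> C (v \<otimes>\<^bsub>G\<^esub> x \<otimes>\<^bsub>G\<^esub> u) (v \<otimes>\<^bsub>G\<^esub> y \<otimes>\<^bsub>G\<^esub> u) (v \<otimes>\<^bsub>G\<^esub> z \<otimes>\<^bsub>G\<^esub> u))"

locale C_quasi_ordered_group = group G
  for G :: "('a, 'm) monoid_scheme" (structure) and qle :: "'a \<Rightarrow> 'a \<Rightarrow> bool" +
  assumes quasi_order: "quasi_order_on (carrier G) qle"
    and C_quasi_order: "\<exists>C. C_relation_on (carrier G) C \<and> C_compatible G C \<and>
      (\<forall>x\<in>carrier G. \<forall>y\<in>carrier G. qle x y \<longleftrightarrow> \<not> C x y \<one>)"

definition v_type :: "('a, 'm) monoid_scheme \<Rightarrow> ('a \<Rightarrow> 'a \<Rightarrow> bool) \<Rightarrow> 'a \<Rightarrow> bool" where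
  "v_type G qle g \<longleftrightarrow> qo_equiv qle g (inv\<^bsub>G\<^esub> g)"

definition o_plus_type :: "('a, 'm) monoid_scheme \<Rightarrow> ('a \<Rightarrow> 'a \<Rightarrow> bool) \<Rightarrow> 'a \<Rightarrow> bool" where
  "o_plus_type G qle g \<longleftrightarrow> qo_less qle (inv\<^bsub>G\<^esub> g) g"

definition o_minus_type :: "('a, 'm) monoid_scheme \<Rightarrow> ('a \<Rightarrow> 'a \<Rightarrow> bool) \<Rightarrow> 'a \<Rightarrow> bool" where
  "o_minus_type G qle g \<longleftrightarrow> qo_less qle g (inv\<^bsub>G\<^esub> g)"

definition T_v :: "('a, 'm) monoid_scheme \<Rightarrow> ('a \<Rightarrow> 'a \<Rightarrow> bool) \<Rightarrow> 'a \<Rightarrow> 'a set" where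
  "T_v G qle g = {h \<in> carrier G. v_type G qle h \<and> h \<noteq> \<one>\<^bsub>G\<^esub> \<and>
     \<not> (\<exists>k\<in>carrier G. o_plus_type G qle k \<and> qo_between qle h g k)}"

definition lower_v :: "('a, 'm) monoid_scheme \<Rightarrow> ('a \<Rightarrow> 'a \<Rightarrow> bool) \<Rightarrow> 'a \<Rightarrow> 'a set" where
  "lower_v G qle g = {h \<in> carrier G. \<forall>t\<in>T_v G qle g. qo_less qle h t}"

definition T_plus :: "('a, 'm) monoid_scheme \<Rightarrow> ('a \<Rightarrow> 'a \<Rightarrow> bool) \<Rightarrow> 'a \<Rightarrow> 'a set" where
  "T_plus G qle g = {h \<in> carrier G. o_plus_type G qle h \<and>
     (\<forall>k\<in>carrier G. qo_between qle g h k \<longrightarrow> o_plus_type G qle k)}"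

definition T_o :: "('a, 'm) monoid_scheme \<Rightarrow> ('a \<Rightarrow> 'a \<Rightarrow> bool) \<Rightarrow> 'a \<Rightarrow> 'a set" where
  "T_o G qle g = T_plus G qle g \<union> (\<lambda>h. inv\<^bsub>G\<^esub> h) ` T_plus G qle g"

definition lower_o :: "('a, 'm) monoid_scheme \<Rightarrow> ('a \<Rightarrow> 'a \<Rightarrow> bool) \<Rightarrow> 'a \<Rightarrow> 'a set" where
  "lower_o G qle g = {h \<in> carrier G. qle h (inv\<^bsub>G\<^esub> g) \<and> qle (inv\<^bsub>G\<^esub> h) (inv\<^bsub>G\<^esub> g)}"

text \<open>The sets \<open>T\<^sub>g\<close>, \<open>G\<^sub>g\<close> and \<open>G\<^sup>g\<close> are \<open>T_set G qle g\<close>, \<open>lower_set G qle g\<close> and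
  \<open>upper_set G qle g\<close>. As the quasi-order is total, every element is of exactly one of
  the three types, so the last branches below treat the elements of \<open>o\<^sup>-\<close>-type, whose inverses
  are of \<open>o\<^sup>+\<close>-type.\<close>

definition T_set :: "('a, 'm) monoid_scheme \<Rightarrow> ('a \<Rightarrow> 'a \<Rightarrow> bool) \<Rightarrow> 'a \<Rightarrow> 'a set" where
  "T_set G qle g =
     (if g = \<one>\<^bsub>G\<^esub> then {\<one>\<^bsub>G\<^esub>}
      else if v_type G qle g then T_v G qle g
      else if o_plus_type G qle g then T_o G qle g
      else T_o G qle (inv\<^bsub>G\<^esub> g))"

definition lower_set :: "('a, 'm) monoid_scheme \<Rightarrow> ('a \<Rightarrow> 'a \<Rightarrow> bool) \<Rightarrow> 'a \<Rightarrow> 'a set" where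
  "lower_set G qle g =
     (if g = \<one>\<^bsub>G\<^esub> then {\<one>\<^bsub>G\<^esub>}
      else if v_type G qle g then lower_v G qle g
      else if o_plus_type G qle g then lower_o G qle g
      else lower_o G qle (inv\<^bsub>G\<^esub> g))"

text \<open>For \<open>g = \<one>\<close> this union is \<open>{\<one>}\<close>, in accordance with the convention
  \<open>G\<^sup>1 = {\<one>}\<close>.\<close>

definition upper_set :: "('a, 'm) monoid_scheme \<Rightarrow> ('a \<Rightarrow> 'a \<Rightarrow> bool) \<Rightarrow> 'a \<Rightarrow> 'a set" where
  "upper_set G qle g = lower_set G qle g \<union> T_set G qle g"

lemma (in C_quasi_ordered_group) type_cases:
  assumes "g \<in> carrier G"
  shows "v_type G qle g \<or> o_plus_type G qle g \<or> o_minus_type G qle g"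
proof (cases "inv g = g")
  case True
  have "qle g g"
    using quasi_order assms by (auto simp: quasi_order_on_def dest: reflp_onD)
  with True show ?thesis by (simp add: v_type_def qo_equiv_def)
next
  case False
  have "qle g (inv g) \<or> qle (inv g) g"
    using quasi_order assms False unfolding quasi_order_on_def
    by (metis inv_closed totalp_onD)
  then show ?thesis
    by (auto simp: v_type_def o_plus_type_def o_minus_type_def qo_less_def qo_equiv_def)
qed

text \<open>Under the convention \<open>G\<^sub>1 = {\<one>}\<close>, the condition \<open>G\<^sub>g = G\<^sub>h\<close> alone does not imply
  \<open>T\<^sub>g = T\<^sub>h\<close> if exactly one of \<open>g\<close>, \<open>h\<close> is \<open>\<one>\<close>: for the trivial C-relation
  \<open>C(x,y,z) \<longleftrightarrow> y = z \<noteq> x\<close> on any group, \<open>G\<^sub>g = {\<one>}\<close> for all \<open>g\<close>, whereas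
  \<open>\<one> \<notin> T\<^sub>g\<close> for \<open>g \<noteq> \<one>\<close>. This is why the theorem combines \<open>G\<^sub>g = G\<^sub>h\<close> with
  \<open>g = \<one> \<longleftrightarrow> h = \<one>\<close>.\<close>

lemma (in group) lower_set_trivial_C:
  fixes qle :: "'a \<Rightarrow> 'a \<Rightarrow> bool"
  assumes triv: "\<And>x y. qle x y \<longleftrightarrow> \<not> (y = \<one> \<and> x \<noteq> \<one>)"
    and g: "g \<in> carrier G"
  shows "C_quasi_ordered_group G qle"
    and "lower_set G qle g = lower_set G qle \<one>"
    and "g \<noteq> \<one> \<Longrightarrow> T_set G qle g \<noteq> T_set G qle \<one>"
proof -
  let ?C = "\<lambda>x y z. y = z \<and> x \<noteq> y"
  have "quasi_order_on (carrier G) qle"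
    by (auto simp: quasi_order_on_def triv reflp_on_def transp_on_def totalp_on_def)
  moreover have "C_relation_on (carrier G) ?C" "C_compatible G ?C"
    by (auto simp: C_relation_on_def C_compatible_def)
  moreover have "\<forall>x\<in>carrier G. \<forall>y\<in>carrier G. qle x y \<longleftrightarrow> \<not> ?C x y \<one>"
    by (auto simp: triv)
  ultimately show "C_quasi_ordered_group G qle"
    by (intro C_quasi_ordered_group.intro C_quasi_ordered_group_axioms.intro group_axioms) blast+
  have v: "v_type G qle x" "\<not> o_plus_type G qle x" if "x \<in> carrier G" for x
    using that by (auto simp: v_type_def o_plus_type_def qo_less_def qo_equiv_def triv)
  have T: "T_v G qle x = carrier G - {\<one>}" for x
    using v by (auto simp: T_v_def)
  show "lower_set G qle g = lower_set G qle \<one>"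
    using g v(1)[OF g]
    by (auto simp: lower_set_def lower_v_def T qo_less_def qo_equiv_def triv)
  show "T_set G qle g \<noteq> T_set G qle \<one>" if "g \<noteq> \<one>"
    using that v(1)[OF g] by (auto simp: T_set_def T)
qed

end

theory Submission
  imports Defs
begin

text \<open>Write \<open>x < y\<close> for \<open>x \<precnsim> y\<close>. Compatibility gives
  \<open>x \<precsim> y \<longleftrightarrow> x y\<inverse> \<precsim> y\<inverse> \<longleftrightarrow> y\<inverse> x \<precsim> y\<inverse>\<close>, and
  \<open>z < w\<inverse>\<close> implies \<open>w \<precsim> w z\<close>. Two consequences carry the whole argument: if \<open>h\<close> is of
  \<open>o\<^sup>+\<close>-type, then so is every \<open>k\<close> with \<open>h\<inverse> < k \<precsim> h\<close>; and \<open>g \<precsim> h\<close>, \<open>g\<inverse> < h\<inverse>\<close> imply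
  \<open>g < h\<inverse>\<close>. By the first one, types are invariant under \<open>\<sim>\<close>, so that the sets \<open>T\<^sub>g\<close> are the classes
  of an equivalence relation. By both, elements \<open>g \<precsim> h\<close> of \<open>o\<^sup>+\<close>-type in one class
  have \<open>g\<inverse> \<sim> h\<inverse>\<close>, hence \<open>G\<^sub>g = G\<^sub>h\<close>, and in different classes \<open>g \<precsim> h\<inverse>\<close>; the elements
  \<open>g\<close>, \<open>h\<close> or their inverses then separate \<open>G\<^sub>g\<close> from \<open>G\<^sub>h\<close> and \<open>G\<^sup>g\<close> from \<open>G\<^sup>h\<close>.\<close>

context C_quasi_ordered_group
begin

section \<open>The quasi-order and the types of elements\<close>

lemma qle_refl: "x \<in> carrier G \<Longrightarrow> qle x x"
  using quasi_order by (auto simp: quasi_order_on_def dest: reflp_onD)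

lemma qle_trans:
  "\<lbrakk>qle x y; qle y z; x \<in> carrier G; y \<in> carrier G; z \<in> carrier G\<rbrakk> \<Longrightarrow> qle x z"
  using quasi_order unfolding quasi_order_on_def by (meson transp_onD)

lemma qle_total: "\<lbrakk>x \<in> carrier G; y \<in> carrier G\<rbrakk> \<Longrightarrow> qle x y \<or> qle y x"
  using quasi_order qle_refl unfolding quasi_order_on_def by (metis totalp_onD)

lemma qo_less_iff: "\<lbrakk>x \<in> carrier G; y \<in> carrier G\<rbrakk> \<Longrightarrow> qo_less qle x y \<longleftrightarrow> \<not> qle y x"
  using qle_total by (auto simp: qo_less_def qo_equiv_def)

lemma o_plus_type_iff: "x \<in> carrier G \<Longrightarrow> o_plus_type G qle x \<longleftrightarrow> \<not> qle x (inv x)"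
  by (simp add: o_plus_type_def qo_less_iff)

lemma o_plus_type_imp_qle: "\<lbrakk>o_plus_type G qle x; x \<in> carrier G\<rbrakk> \<Longrightarrow> qle (inv x) x"
  by (simp add: o_plus_type_def qo_less_def)

lemma v_type_iff:
  "x \<in> carrier G \<Longrightarrow>
    v_type G qle x \<longleftrightarrow> \<not> o_plus_type G qle x \<and> \<not> o_plus_type G qle (inv x)"
  by (auto simp: o_plus_type_iff v_type_def qo_equiv_def)

lemma v_type_inv_iff: "x \<in> carrier G \<Longrightarrow> v_type G qle (inv x) \<longleftrightarrow> v_type G qle x"
  by (auto simp: v_type_iff)

lemma not_o_plus_type_inv:
  "\<lbrakk>o_plus_type G qle x; x \<in> carrier G\<rbrakk> \<Longrightarrow> \<not> o_plus_type G qle (inv x)"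
  by (simp add: o_plus_type_iff) (metis qle_total inv_closed)

lemma o_plus_type_neq_one: "o_plus_type G qle x \<Longrightarrow> x \<noteq> \<one>"
  by (auto simp: o_plus_type_def qo_less_def qo_equiv_def)

section \<open>Translation and inversion in the quasi-order\<close>

text \<open>Translating C(x, y, 1) by \<open>inv y\<close> on either side turns y into 1 and 1 into
  \<open>inv y\<close>; the symmetry of C in its last two arguments brings 1 back to the last place.
  Translating by y undoes this.\<close>

lemma qle_iff_translate:
  assumes x: "x \<in> carrier G" and y: "y \<in> carrier G"
  shows qle_iff_right_translate: "qle x y \<longleftrightarrow> qle (x \<otimes> inv y) (inv y)"
    and qle_iff_left_translate: "qle x y \<longleftrightarrow> qle (inv y \<otimes> x) (inv y)"
proof -
  obtain C where rel: "C_relation_on (carrier G) C" and comp: "C_compatible G C"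
    and qle: "\<And>a b. \<lbrakk>a \<in> carrier G; b \<in> carrier G\<rbrakk> \<Longrightarrow> qle a b \<longleftrightarrow> \<not> C a b \<one>"
    using C_quasi_order by auto
  have sym: "C a b c \<longleftrightarrow> C a c b"
    if "a \<in> carrier G" "b \<in> carrier G" "c \<in> carrier G" for a b c
    using rel that unfolding C_relation_on_def by blast
  have tr: "C a b c \<Longrightarrow> C (v \<otimes> a \<otimes> u) (v \<otimes> b \<otimes> u) (v \<otimes> c \<otimes> u)"
    if "a \<in> carrier G" "b \<in> carrier G" "c \<in> carrier G" "u \<in> carrier G" "v \<in> carrier G"
    for a b c u v
    using comp that unfolding C_compatible_def by blast
  have "C x y \<one> \<longleftrightarrow> C (x \<otimes> inv y) \<one> (inv y)"
    using tr[of x y \<one> "inv y" \<one>] tr[of "x \<otimes> inv y" \<one> "inv y" y \<one>] x y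
    by (auto simp: m_assoc)
  then show "qle x y \<longleftrightarrow> qle (x \<otimes> inv y) (inv y)"
    using x y sym[of "x \<otimes> inv y" \<one> "inv y"] by (simp add: qle)
  have "C x y \<one> \<longleftrightarrow> C (inv y \<otimes> x) \<one> (inv y)"
    using tr[of x y \<one> \<one> "inv y"] tr[of "inv y \<otimes> x" \<one> "inv y" \<one> y] x y
    by (auto simp: m_assoc[symmetric])
  then show "qle x y \<longleftrightarrow> qle (inv y \<otimes> x) (inv y)"
    using x y sym[of "inv y \<otimes> x" \<one> "inv y"] by (simp add: qle)
qed

text \<open>The assumption \<open>less\<close> says C(inv w, z, 1). Left translation by w gives C(1,
  wz, w), that is C(1, w, wz), and this excludes C(w, 1, wz).\<close>

lemma qle_mult_right:
  assumes w: "w \<in> carrier G" and z: "z \<in> carrier G" and less: "\<not> qle (inv w) z"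
  shows "qle w (w \<otimes> z)"
proof -
  obtain C where rel: "C_relation_on (carrier G) C" and comp: "C_compatible G C"
    and qle: "\<And>a b. \<lbrakk>a \<in> carrier G; b \<in> carrier G\<rbrakk> \<Longrightarrow> qle a b \<longleftrightarrow> \<not> C a b \<one>"
    using C_quasi_order by auto
  have "C (inv w) z \<one>"
    using less w z by (simp add: qle)
  then have "C (w \<otimes> inv w \<otimes> \<one>) (w \<otimes> z \<otimes> \<one>) (w \<otimes> \<one> \<otimes> \<one>)"
    using comp w z unfolding C_compatible_def by blast
  then have "C \<one> (w \<otimes> z) w"
    using w z by simp
  then have "\<not> C w \<one> (w \<otimes> z)"
    using rel w z unfolding C_relation_on_def by (meson m_closed one_closed)
  then have "\<not> C w (w \<otimes> z) \<one>"
    using rel w z unfolding C_relation_on_def by (meson m_closed one_closed)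
  then show ?thesis
    using w z by (simp add: qle)
qed

text \<open>If k \<le> \<open>inv k\<close>, then \<open>inv h\<close> < \<open>inv k\<close>, so k
  \<le> \<open>k \<otimes> inv h\<close> by \<open>qle_mult_right\<close>; the right translate of k
  \<le> h is \<open>k \<otimes> inv h\<close> \<le> \<open>inv h\<close>. Together they contradict
  \<open>inv h\<close> < k.\<close>

lemma o_plus_type_interval:
  assumes h: "h \<in> carrier G" and k: "k \<in> carrier G"
    and less: "\<not> qle k (inv h)" and le: "qle k h"
  shows "o_plus_type G qle k"
proof (rule ccontr)
  assume "\<not> o_plus_type G qle k"
  then have kk: "qle k (inv k)"
    using k by (simp add: o_plus_type_iff)
  have "\<not> qle (inv k) (inv h)"
    using qle_trans[OF kk] less h k by blast
  then have "qle k (k \<otimes> inv h)"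
    using h k by (intro qle_mult_right) auto
  moreover have "qle (k \<otimes> inv h) (inv h)"
    using qle_iff_right_translate[OF k h] le by simp
  ultimately have "qle k (inv h)"
    by (rule qle_trans) (use h k in auto)
  then show False
    using less by simp
qed

text \<open>If \<open>inv h\<close> < g, the right translate \<open>k \<le> inv h\<close> of g \<le>
  h, with \<open>k = g \<otimes> inv h\<close>, yields k \<le> g, which is the left translate of
  \<open>inv h\<close> \<le> \<open>inv g\<close>.\<close>

lemma qle_inv_cases:
  assumes g: "g \<in> carrier G" and h: "h \<in> carrier G" and le: "qle g h"
  shows "qle (inv h) (inv g) \<or> qle g (inv h)"
proof (rule disjCI)
  assume n: "\<not> qle g (inv h)"
  have "qle (g \<otimes> inv h) (inv h)"
    using qle_iff_right_translate[OF g h] le by simp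
  with n have "\<not> qle g (g \<otimes> inv h)"
    using qle_trans[of g "g \<otimes> inv h" "inv h"] g h by auto
  then show "qle (inv h) (inv g)"
    using qle_iff_left_translate[of "inv h" "inv g"] qle_total[of g "g \<otimes> inv h"] g h by auto
qed

text \<open>Otherwise \<open>inv h\<close> < \<open>inv g\<close> \<le> g \<le> h, and
  \<open>o_plus_type_interval\<close> would make g and \<open>inv g\<close> both of
  \<open>o\<^sup>+\<close>-type.\<close>

lemma o_plus_type_inv_mono:
  assumes g: "g \<in> carrier G" "o_plus_type G qle g" and h: "h \<in> carrier G" and le: "qle g h"
  shows "qle (inv g) (inv h)"
proof (rule ccontr)
  assume n: "\<not> qle (inv g) (inv h)"
  have "qle (inv g) h"
    using qle_trans[OF o_plus_type_imp_qle[OF g(2,1)] le] g h by simp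
  then have "o_plus_type G qle (inv g)"
    using o_plus_type_interval[of h "inv g"] n g h by simp
  then show False
    using not_o_plus_type_inv g by blast
qed

text \<open>The elements between g and g are those equivalent to g, so this is what puts g into its
  own class.\<close>

lemma o_plus_type_equiv:
  assumes "h \<in> carrier G" "k \<in> carrier G" "o_plus_type G qle h" "qle h k" "qle k h"
  shows "o_plus_type G qle k"
  using o_plus_type_interval[of h k] qle_trans[of h k "inv h"] assms
  by (auto simp: o_plus_type_iff)

section \<open>The classes \<open>T\<^sub>g\<close> within a single type\<close>

lemma T_v_self:
  assumes "g \<in> carrier G" "v_type G qle g" "g \<noteq> \<one>"
  shows "g \<in> T_v G qle g"
  using assms o_plus_type_equiv[of _ g] unfolding T_v_def qo_between_def
  by (auto simp: v_type_iff)

lemma T_v_sym: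
  assumes "g \<in> carrier G" "v_type G qle g" "g \<noteq> \<one>" "h \<in> T_v G qle g"
  shows "g \<in> T_v G qle h"
  using assms unfolding T_v_def qo_between_def by blast

text \<open>Source of transitivity for the classes: an element of a forbidden type between the outer
  two, compared with b, lies between b and one of them.\<close>

lemma qo_between_trans:
  assumes "qo_between qle a c k" "a \<in> carrier G" "b \<in> carrier G" "c \<in> carrier G" "k \<in> carrier G"
  shows "qo_between qle a b k \<or> qo_between qle b c k"
  using assms qle_total[of b k] unfolding qo_between_def by blast

lemma T_v_trans:
  assumes "g \<in> carrier G" "h \<in> T_v G qle g"
  shows "T_v G qle h \<subseteq> T_v G qle g"
  using assms qo_between_trans[of _ g _ h] unfolding T_v_def by blast

lemma T_v_eq:
  assumes "g \<in> carrier G" "v_type G qle g" "g \<noteq> \<one>" "h \<in> T_v G qle g"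
  shows "T_v G qle h = T_v G qle g"
  using assms T_v_trans[of g h] T_v_trans[of h g] T_v_sym[of g h]
  by (auto simp: T_v_def)

lemma T_plus_self:
  assumes "g \<in> carrier G" "o_plus_type G qle g"
  shows "g \<in> T_plus G qle g"
  using assms o_plus_type_equiv[of g] unfolding T_plus_def qo_between_def by auto

lemma T_plus_sym:
  assumes "g \<in> carrier G" "o_plus_type G qle g" "h \<in> T_plus G qle g"
  shows "g \<in> T_plus G qle h"
  using assms unfolding T_plus_def qo_between_def by blast

lemma T_plus_trans:
  assumes "g \<in> carrier G" "h \<in> T_plus G qle g"
  shows "T_plus G qle h \<subseteq> T_plus G qle g"
  using assms qo_between_trans[of g _ _ h] unfolding T_plus_def by blast

lemma T_plus_eq:
  assumes "g \<in> carrier G" "o_plus_type G qle g" "h \<in> T_plus G qle g"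
  shows "T_plus G qle h = T_plus G qle g"
  using assms T_plus_trans[of g h] T_plus_trans[of h g] T_plus_sym[of g h]
  by (auto simp: T_plus_def)

lemma T_o_eq:
  "\<lbrakk>g \<in> carrier G; o_plus_type G qle g; h \<in> T_plus G qle g\<rbrakk> \<Longrightarrow> T_o G qle h = T_o G qle g"
  using T_plus_eq by (simp add: T_o_def)

text \<open>The element \<open>inv h\<close> alone decides. If g \<le> \<open>inv h\<close>, it lies
  between g and h and is not of \<open>o\<^sup>+\<close>-type; otherwise everything from g to h lies
  in the interval of \<open>o_plus_type_interval\<close>.\<close>

lemma T_plus_iff_o:
  assumes "g \<in> carrier G" "o_plus_type G qle g" "h \<in> carrier G" "o_plus_type G qle h" "qle g h"
  shows "h \<in> T_plus G qle g \<longleftrightarrow> \<not> qle g (inv h)"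
proof
  assume h: "h \<in> T_plus G qle g"
  show "\<not> qle g (inv h)"
  proof
    assume "qle g (inv h)"
    then have "qo_between qle g h (inv h)"
      using assms o_plus_type_imp_qle by (simp add: qo_between_def)
    then show False
      using h assms not_o_plus_type_inv by (auto simp: T_plus_def)
  qed
next
  assume n: "\<not> qle g (inv h)"
  have "o_plus_type G qle k" if k: "k \<in> carrier G" "qo_between qle g h k" for k
  proof -
    \<comment> \<open>In the other order of betweenness, h \<le> k \<le> g, all three elements are
      equivalent because g \<le> h.\<close>
    have "qle g k" "qle k h"
      using k assms qle_trans[of g h k] qle_trans[of k g h]
      by (auto simp: qo_between_def)
    then show ?thesis
      using o_plus_type_interval[of h k] qle_trans[of g k "inv h"] n k assms by auto
  qed
  then show "h \<in> T_plus G qle g"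
    using assms by (auto simp: T_plus_def)
qed

text \<open>The set depends on g only through upper bounds by \<open>inv g\<close>, so
  \<open>inv g\<close> ~ \<open>inv h\<close> suffices. For g \<le> h one inequality is
  \<open>o_plus_type_inv_mono\<close>; the other is what \<open>qle_inv_cases\<close> leaves once
  \<open>T_plus_iff_o\<close> excludes g \<le> \<open>inv h\<close>.\<close>

lemma lower_o_eq:
  assumes g: "g \<in> carrier G" "o_plus_type G qle g" and h: "h \<in> T_plus G qle g"
  shows "lower_o G qle g = lower_o G qle h"
proof -
  have *: "qle (inv a) (inv b) \<and> qle (inv b) (inv a)"
    if "a \<in> carrier G" "o_plus_type G qle a" "b \<in> T_plus G qle a" "qle a b" for a b
    using that o_plus_type_inv_mono[of a b] qle_inv_cases[of a b] T_plus_iff_o[of a b]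
    by (auto simp: T_plus_def)
  have hc: "h \<in> carrier G" "o_plus_type G qle h"
    using h by (auto simp: T_plus_def)
  have "qle (inv g) (inv h) \<and> qle (inv h) (inv g)"
    using qle_total[OF g(1) hc(1)] *[OF g h] *[OF hc T_plus_sym[OF g h]] by blast
  then show ?thesis
    unfolding lower_o_def using g hc by (blast intro: qle_trans inv_closed)
qed

text \<open>Everything between g and \<open>inv g\<close> is equivalent to g, hence not of
  \<open>o\<^sup>+\<close>-type.\<close>

lemma T_v_inv:
  assumes "g \<in> carrier G" "v_type G qle g" "g \<noteq> \<one>"
  shows "T_v G qle (inv g) = T_v G qle g"
proof (rule T_v_eq[OF assms])
  have "\<not> o_plus_type G qle k"
    if "k \<in> carrier G" "qo_between qle (inv g) g k" for k
    using that assms o_plus_type_equiv[of k g] qle_trans[of g "inv g" k] qle_trans[of k "inv g" g]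
    by (auto simp: v_type_iff qo_between_def o_plus_type_iff)
  then show "inv g \<in> T_v G qle g"
    using assms by (auto simp: T_v_def v_type_inv_iff)
qed

section \<open>The sets \<open>T\<^sub>g\<close> and \<open>G\<^sub>g\<close> across all
  types\<close>

lemma T_set_v: "\<lbrakk>v_type G qle g; g \<noteq> \<one>\<rbrakk> \<Longrightarrow> T_set G qle g = T_v G qle g"
  by (simp add: T_set_def)

lemma lower_set_v: "\<lbrakk>v_type G qle g; g \<noteq> \<one>\<rbrakk> \<Longrightarrow> lower_set G qle g = lower_v G qle g"
  by (simp add: lower_set_def)

lemma T_set_o_plus:
  "\<lbrakk>g \<in> carrier G; o_plus_type G qle g\<rbrakk> \<Longrightarrow> T_set G qle g = T_o G qle g"
  using o_plus_type_neq_one[of g] by (simp add: T_set_def v_type_iff)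

lemma lower_set_o_plus:
  "\<lbrakk>g \<in> carrier G; o_plus_type G qle g\<rbrakk> \<Longrightarrow> lower_set G qle g = lower_o G qle g"
  using o_plus_type_neq_one[of g] by (simp add: lower_set_def v_type_iff)

text \<open>Allows an element of \<open>o\<^sup>-\<close>-type to be replaced by its inverse, of
  \<open>o\<^sup>+\<close>-type.\<close>

lemma sets_inv:
  assumes "g \<in> carrier G"
  shows "T_set G qle (inv g) = T_set G qle g" "lower_set G qle (inv g) = lower_set G qle g"
  using assms not_o_plus_type_inv[of g] T_v_inv[of g] inv_eq_1_iff[of g]
    v_type_iff[of g] v_type_inv_iff[of g]
  by (auto simp: T_set_def lower_set_def lower_v_def)

lemma T_set_self:
  assumes "g \<in> carrier G"
  shows "g \<in> T_set G qle g"
proof -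
  consider "g = \<one>" | "v_type G qle g" "g \<noteq> \<one>" | "o_plus_type G qle g"
    | "o_plus_type G qle (inv g)"
    using assms v_type_iff[of g] by blast
  then show ?thesis
  proof cases
    case 1
    then show ?thesis by (simp add: T_set_def)
  next
    case 2
    then show ?thesis using assms T_v_self by (simp add: T_set_v)
  next
    case 3
    then show ?thesis using assms T_plus_self by (simp add: T_set_o_plus T_o_def)
  next
    case 4
    then have "inv (inv g) \<in> T_o G qle (inv g)"
      unfolding T_o_def using assms by (intro UnI2 imageI T_plus_self) auto
    then show ?thesis
      using 4 assms T_set_o_plus[of "inv g"] by (simp add: sets_inv)
  qed
qed

lemma sets_eq:
  assumes g: "g \<in> carrier G" and h: "h \<in> T_set G qle g"
  shows "h \<in> carrier G \<and> T_set G qle h = T_set G qle g \<and> lower_set G qle h = lower_set G qle g \<and>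
    (h = \<one> \<longleftrightarrow> g = \<one>)"
proof -
  \<comment> \<open>Serves g of \<open>o\<^sup>+\<close>-type with x = g, and g of
    \<open>o\<^sup>-\<close>-type with x = \<open>inv g\<close>.\<close>
  have o: "h \<in> carrier G \<and> T_set G qle h = T_set G qle x \<and> lower_set G qle h = lower_set G qle x \<and>
    h \<noteq> \<one>"
    if x: "x \<in> carrier G" "o_plus_type G qle x" and hx: "h \<in> T_o G qle x" for x
  proof -
    obtain y where y: "y \<in> T_plus G qle x" and hy: "h = y \<or> h = inv y"
      using hx by (auto simp: T_o_def)
    have yc: "y \<in> carrier G" "o_plus_type G qle y"
      using y by (auto simp: T_plus_def)
    have "T_set G qle y = T_set G qle x" "lower_set G qle y = lower_set G qle x"
      using T_o_eq[OF x y] lower_o_eq[OF x y] x yc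
      by (simp_all add: T_set_o_plus lower_set_o_plus)
    then show ?thesis
      using hy yc o_plus_type_neq_one[of y] by (auto simp: sets_inv)
  qed
  consider "g = \<one>" | "v_type G qle g" "g \<noteq> \<one>" | "o_plus_type G qle g"
    | "o_plus_type G qle (inv g)"
    using g v_type_iff[of g] by blast
  then show ?thesis
  proof cases
    case 1
    then show ?thesis using h by (simp add: T_set_def)
  next
    case 2
    then have hT: "h \<in> T_v G qle g"
      using h by (simp add: T_set_v)
    then have "h \<in> carrier G" "v_type G qle h" "h \<noteq> \<one>"
      by (auto simp: T_v_def)
    then show ?thesis
      using 2 T_v_eq[OF g 2 hT] by (simp add: T_set_v lower_set_v lower_v_def)
  next
    case 3
    then show ?thesis
      using o[of g] h g o_plus_type_neq_one[of g] by (simp add: T_set_o_plus)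
  next
    case 4
    then have "h \<in> T_o G qle (inv g)"
      using h g T_set_o_plus[of "inv g"] by (simp add: sets_inv)
    then show ?thesis
      using o[of "inv g"] 4 g o_plus_type_neq_one[of "inv g"] by (auto simp: sets_inv)
  qed
qed

section \<open>Different classes have different lower and upper sets\<close>

text \<open>Some k of \<open>o\<^sup>+\<close>-type satisfies g \<le> k \<le> h. A t in
  \<open>T\<^sub>h\<close> with t \<le> g would have k between t and h, so g lies strictly below
  \<open>T\<^sub>h\<close>. As g is in \<open>T\<^sub>g\<close>, neither g nor the larger h lies in
  \<open>G\<^sub>g\<close>.\<close>

lemma separate_v_v:
  assumes g: "g \<in> carrier G" "v_type G qle g" "g \<noteq> \<one>"
    and h: "h \<in> carrier G" "v_type G qle h" "h \<noteq> \<one>"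
    and le: "qle g h" and T: "h \<notin> T_set G qle g"
  shows "g \<in> lower_set G qle h - lower_set G qle g \<and> h \<notin> upper_set G qle g"
proof -
  obtain k where k: "k \<in> carrier G" "o_plus_type G qle k" "qo_between qle h g k"
    using T g h by (auto simp: T_set_v T_v_def)
  have gk: "qle g k" and kh: "qle k h"
    using k le g h qle_trans[of g h k] qle_trans[of k g h] by (auto simp: qo_between_def)
  have "\<not> qle t g" if t: "t \<in> T_v G qle h" for t
  proof
    assume "qle t g"
    then have "qle t k"
      using qle_trans[of t g k] gk t g k by (auto simp: T_v_def)
    then show False
      using t kh k by (auto simp: T_v_def qo_between_def)
  qed
  then have "g \<in> lower_v G qle h"
    using g by (auto simp: lower_v_def T_v_def qo_less_iff)
  moreover have "g \<notin> lower_v G qle g" "h \<notin> lower_v G qle g"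
    using T_v_self[OF g] g h le qle_refl[OF g(1)]
    by (auto simp: lower_v_def qo_less_iff intro!: bexI[of _ g])
  ultimately show ?thesis
    using T g h by (simp add: T_set_v lower_set_v upper_set_def)
qed

text \<open>Being in different classes means g \<le> \<open>inv h\<close>, and \<open>inv g\<close>
  \<le> \<open>inv h\<close> by monotonicity, so g is in \<open>G\<^sub>h\<close>. Membership of g
  or h in \<open>G\<^sub>g\<close> would force g \<le> \<open>inv g\<close>.\<close>

lemma separate_o_o:
  assumes g: "g \<in> carrier G" "o_plus_type G qle g"
    and h: "h \<in> carrier G" "o_plus_type G qle h"
    and le: "qle g h" and T: "h \<notin> T_set G qle g"
  shows "g \<in> lower_set G qle h - lower_set G qle g \<and> h \<notin> upper_set G qle g"
proof -
  have gh: "qle g (inv h)"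
    using T T_plus_iff_o[OF g h le] g by (auto simp: T_set_o_plus T_o_def)
  have "g \<in> lower_o G qle h"
    using gh o_plus_type_inv_mono[OF g h(1) le] g by (simp add: lower_o_def)
  moreover have "g \<notin> lower_o G qle g"
    using g by (simp add: lower_o_def o_plus_type_iff)
  moreover have "h \<notin> lower_o G qle g"
  proof
    assume "h \<in> lower_o G qle g"
    then have "qle h (inv g)"
      by (simp add: lower_o_def)
    then have "qle g (inv g)"
      using qle_trans[OF le] g h by blast
    then show False
      using g by (simp add: o_plus_type_iff)
  qed
  ultimately show ?thesis
    using T g h by (simp add: lower_set_o_plus upper_set_def)
qed

lemma T_v_T_o_disjoint:
  assumes "g \<in> T_v G qle x"
  shows "g \<notin> T_o G qle y"
  using assms by (auto simp: T_v_def T_o_def T_plus_def v_type_iff)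

text \<open>If g \<le> \<open>inv h\<close>, then g separates the lower sets and h the upper sets;
  if \<open>inv h\<close> < g, then \<open>inv h\<close> separates the lower sets and g the upper
  sets.\<close>

lemma separate_v_o:
  assumes g: "g \<in> carrier G" "v_type G qle g" "g \<noteq> \<one>"
    and h: "h \<in> carrier G" "o_plus_type G qle h"
  shows "lower_set G qle g \<noteq> lower_set G qle h \<and> upper_set G qle g \<noteq> upper_set G qle h"
proof (cases "qle g (inv h)")
  case True
  have "qle (inv g) (inv h)"
    using qle_trans[of "inv g" g "inv h"] True g h by (auto simp: v_type_def qo_equiv_def)
  then have "g \<in> lower_o G qle h"
    using True g by (simp add: lower_o_def)
  moreover have "g \<notin> lower_v G qle g"
    using T_v_self[OF g] g qle_refl[OF g(1)]
    by (auto simp: lower_v_def qo_less_iff intro!: bexI[of _ g])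
  moreover have "h \<notin> lower_v G qle g"
    using T_v_self[OF g] g h qle_trans[OF True o_plus_type_imp_qle[OF h(2,1)]]
    by (auto simp: lower_v_def qo_less_iff intro!: bexI[of _ g])
  moreover have "h \<in> T_o G qle h" "h \<notin> T_v G qle g"
    using T_plus_self[OF h] h by (auto simp: T_o_def T_v_def v_type_iff)
  ultimately show ?thesis
    using g h unfolding upper_set_def
    by (simp add: T_set_v lower_set_v T_set_o_plus lower_set_o_plus) blast
next
  case False
  \<comment> \<open>Otherwise \<open>inv h\<close> < g \<le> h would make g of
    \<open>o\<^sup>+\<close>-type.\<close>
  have hg: "qle h g"
    using o_plus_type_interval[OF h(1) g(1) False] qle_total[of g h] g h
    by (auto simp: v_type_iff)
  \<comment> \<open>Such a t would satisfy t \<le> \<open>inv h\<close> \<le> h \<le> g, placing the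
    \<open>o\<^sup>+\<close>-type element h between t and g.\<close>
  have "\<not> qle t (inv h)" if t: "t \<in> T_v G qle g" for t
    using t h hg qle_trans[of t "inv h" h] o_plus_type_imp_qle[OF h(2,1)]
    by (auto simp: T_v_def qo_between_def)
  then have "inv h \<in> lower_v G qle g"
    using h by (auto simp: lower_v_def qo_less_iff T_v_def)
  moreover have "inv h \<notin> lower_o G qle h" "g \<notin> lower_o G qle h"
    using h False by (auto simp: lower_o_def o_plus_type_iff)
  moreover have "g \<in> T_v G qle g" "g \<notin> T_o G qle h"
    using T_v_self[OF g] T_v_T_o_disjoint by blast+
  ultimately show ?thesis
    using g h unfolding upper_set_def
    by (simp add: T_set_v lower_set_v T_set_o_plus lower_set_o_plus) blast
qed

lemma T_set_mem_iff:
  assumes "g \<in> carrier G" "h \<in> carrier G"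
  shows "h \<in> T_set G qle g \<longleftrightarrow> T_set G qle g = T_set G qle h"
  using sets_eq[OF assms(1), of h] T_set_self[OF assms(2)] by auto

lemma separate_aux:
  assumes g: "g \<in> carrier G" "g \<noteq> \<one>" "v_type G qle g \<or> o_plus_type G qle g"
    and h: "h \<in> carrier G" "h \<noteq> \<one>" "v_type G qle h \<or> o_plus_type G qle h"
    and T: "T_set G qle g \<noteq> T_set G qle h"
  shows "lower_set G qle g \<noteq> lower_set G qle h \<and> upper_set G qle g \<noteq> upper_set G qle h"
proof -
  have upper: "x \<in> upper_set G qle x" if "x \<in> carrier G" for x
    using T_set_self[OF that] by (simp add: upper_set_def)
  have n: "h \<notin> T_set G qle g" "g \<notin> T_set G qle h"
    using T T_set_mem_iff[of g h] T_set_mem_iff[of h g] g h by auto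
  consider "v_type G qle g" "v_type G qle h" | "o_plus_type G qle g" "o_plus_type G qle h"
    | "v_type G qle g" "o_plus_type G qle h" | "o_plus_type G qle g" "v_type G qle h"
    using g h by blast
  then show ?thesis
  proof cases
    case 1
    then show ?thesis
      using separate_v_v[of g h] separate_v_v[of h g] qle_total[of g h] g h n upper by blast
  next
    case 2
    then show ?thesis
      using separate_o_o[of g h] separate_o_o[of h g] qle_total[of g h] g h n upper by blast
  next
    case 3
    then show ?thesis using separate_v_o[of g h] g h by blast
  next
    case 4
    then show ?thesis using separate_v_o[of h g] g h by metis
  qed
qed

lemma v_or_o_plus_representative:
  assumes "g \<in> carrier G"
  obtains x where "x \<in> carrier G" "v_type G qle x \<or> o_plus_type G qle x" "x = \<one> \<longleftrightarrow> g = \<one>"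
    "T_set G qle x = T_set G qle g" "lower_set G qle x = lower_set G qle g"
  using that[of g] that[of "inv g"] assms v_type_iff[of g] sets_inv[of g] by auto

lemma separate:
  assumes g: "g \<in> carrier G" "g \<noteq> \<one>" and h: "h \<in> carrier G" "h \<noteq> \<one>"
    and T: "T_set G qle g \<noteq> T_set G qle h"
  shows "lower_set G qle g \<noteq> lower_set G qle h \<and> upper_set G qle g \<noteq> upper_set G qle h"
proof -
  obtain x where x: "x \<in> carrier G" "v_type G qle x \<or> o_plus_type G qle x" "x = \<one> \<longleftrightarrow> g = \<one>"
    "T_set G qle x = T_set G qle g" "lower_set G qle x = lower_set G qle g"
    using v_or_o_plus_representative[OF g(1)] by blast
  obtain y where y: "y \<in> carrier G" "v_type G qle y \<or> o_plus_type G qle y" "y = \<one> \<longleftrightarrow> h = \<one>"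
    "T_set G qle y = T_set G qle h" "lower_set G qle y = lower_set G qle h"
    using v_or_o_plus_representative[OF h(1)] by blast
  show ?thesis
    using separate_aux[of x y] x y g h T by (simp add: upper_set_def)
qed

text \<open>Since g lies in \<open>G\<^sup>g\<close>, equality of upper sets by itself ensures that
  g and h are both the identity or both different from it.\<close>

lemma upper_set_one_iff:
  assumes "g \<in> carrier G"
  shows "upper_set G qle g = {\<one>} \<longleftrightarrow> g = \<one>"
proof
  assume "upper_set G qle g = {\<one>}"
  moreover have "g \<in> upper_set G qle g"
    using T_set_self[OF assms] by (simp add: upper_set_def)
  ultimately show "g = \<one>"
    by simp
qed (simp add: upper_set_def lower_set_def T_set_def)

end

theorem proposition3p32:
  fixes G :: "('a, 'm) monoid_scheme" and qle :: "'a \<Rightarrow> 'a \<Rightarrow> bool" and g h :: 'a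
  assumes "C_quasi_ordered_group G qle"
    and "g \<in> carrier G" and "h \<in> carrier G"
  shows "(g \<in> T_set G qle h \<longleftrightarrow> h \<in> T_set G qle g) \<and>
    (h \<in> T_set G qle g \<longleftrightarrow> T_set G qle g = T_set G qle h) \<and>
    (T_set G qle g = T_set G qle h \<longleftrightarrow> T_set G qle g \<inter> T_set G qle h \<noteq> {}) \<and>
    (T_set G qle g \<inter> T_set G qle h \<noteq> {} \<longleftrightarrow>
       lower_set G qle g = lower_set G qle h \<and> (g = \<one>\<^bsub>G\<^esub> \<longleftrightarrow> h = \<one>\<^bsub>G\<^esub>)) \<and>
    (lower_set G qle g = lower_set G qle h \<and> (g = \<one>\<^bsub>G\<^esub> \<longleftrightarrow> h = \<one>\<^bsub>G\<^esub>) \<longleftrightarrow>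
       upper_set G qle g = upper_set G qle h)"
proof -
  interpret C_quasi_ordered_group G qle
    by fact
  note g = assms(2) and h = assms(3)
  have mem: "h \<in> T_set G qle g \<longleftrightarrow> T_set G qle g = T_set G qle h"
    "g \<in> T_set G qle h \<longleftrightarrow> T_set G qle g = T_set G qle h"
    using T_set_mem_iff g h by auto
  have "T_set G qle g = T_set G qle h" if "x \<in> T_set G qle g \<inter> T_set G qle h" for x
    using that sets_eq[OF g, of x] sets_eq[OF h, of x] by simp
  then have meet: "T_set G qle g \<inter> T_set G qle h \<noteq> {} \<longleftrightarrow> T_set G qle g = T_set G qle h"
    using T_set_self[OF g] by blast
  have same: "lower_set G qle g = lower_set G qle h \<and> (g = \<one>\<^bsub>G\<^esub> \<longleftrightarrow> h = \<one>\<^bsub>G\<^esub>)"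
    "upper_set G qle g = upper_set G qle h" if "T_set G qle g = T_set G qle h"
    using that mem(1) sets_eq[OF g, of h] unfolding upper_set_def by blast+
  have one: "T_set G qle g = T_set G qle h" if "g = \<one>\<^bsub>G\<^esub>" "h = \<one>\<^bsub>G\<^esub>"
    unfolding that ..
  \<comment> \<open>Either both elements are the identity, which is trivial, or neither is and
    \<open>separate\<close> applies in contrapositive form.\<close>
  have lower: "T_set G qle g = T_set G qle h"
    if "lower_set G qle g = lower_set G qle h \<and> (g = \<one>\<^bsub>G\<^esub> \<longleftrightarrow> h = \<one>\<^bsub>G\<^esub>)"
    using that one separate[OF g _ h] by blast
  have "g = \<one>\<^bsub>G\<^esub> \<longleftrightarrow> h = \<one>\<^bsub>G\<^esub>" if "upper_set G qle g = upper_set G qle h"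
    using that upper_set_one_iff[OF g] upper_set_one_iff[OF h] by simp
  then have upper: "T_set G qle g = T_set G qle h" if "upper_set G qle g = upper_set G qle h"
    using that one separate[OF g _ h] by blast
  show ?thesis
    using mem meet same lower upper by argo
qed

end
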